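(* Let $A, B, C, X \in \mathbb{R}^{n\times n}$. If $A$ and $B$ are nonsingular, then the T-congruence Sylvester equation $AX + X^{\mathrm T}B = C$ can be transformed into the Sylvester equation $$-M\tilde X + \tilde X (M^{-1})^{\mathrm T} = Q',$$ where $\tilde X := AX$, $M := B^{\mathrm T}A^{-1}$, and $Q' := \mathrm{vec}^{-1}\bigl\{(M^{-1}\otimes I_n)c'\bigr\}$ with $c' := \{I_n\otimes I_n - P_{nn}(I_n\otimes M)\}\,\mathrm{vec}(C)$.
   Context: In the T-congruence Sylvester equation $AX + X^{\mathrm T}B = C$ the matrices $A,B,C$ are given and $X$ is to be determined; $X^{\mathrm T}$ denotes the transpose of $X$. For a matrix $Y\in\mathbb{R}^{n\times n}$ with columns $y_1,\dots,y_n$, $\mathrm{vec}(Y)\in\mathbb{R}^{n^2}$ is the vector obtained by stacking $y_1,\dots,y_n$ on top of each other in this order, and $\mathrm{vec}^{-1}:\mathbb{R}^{n^2}\to\mathbb{R}^{n\times n}$ is the inverse operator, so $\mathrm{vec}^{-1}(\mathrm{vec}(Y))=Y$. Let $e_{in}\in\mathbb{R}^n$ be the column vector with $1$ in position $i$ and $0$ elsewhere, $I_n$ the $n\times n$ identity matrix, and $\otimes$ the Kronecker (tensor) product, i.e. $Y\otimes Z$ is the block matrix whose $(i,j)$ block is $y_{ij}Z$. $P_{nn}\in\mathbb{R}^{n^2\times n^2}$ is the permutation matrix obtained by stacking vertically the blocks $I_n\otimes e_{1n}^{\mathrm T},\ I_n\otimes e_{2n}^{\mathrm T},\dots,\ I_n\otimes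 e_{nn}^{\mathrm T}$ in this order. *)

theory Defs
  imports "Jordan_Normal_Form.Gauss_Jordan_Elimination"
begin

text \<open>Matrices and vectors are those of Jordan Normal Form, so all indices start at 0: the unit vector
  $e_{in}$ is \<open>unit_vec n (i - 1)\<close>.\<close>

definition kron :: "'a :: times mat \<Rightarrow> 'a mat \<Rightarrow> 'a mat"  (infixl "\<otimes>\<^sub>K" 70) where
  "Y \<otimes>\<^sub>K Z = mat (dim_row Y * dim_row Z) (dim_col Y * dim_col Z)
     (\<lambda>(r, c). Y $$ (r div dim_row Z, c div dim_col Z) * Z $$ (r mod dim_row Z, c mod dim_col Z))"

definition vectorize :: "'a mat \<Rightarrow> 'a vec" where
  "vectorize Y = vec_of_list (concat (map list_of_vec (cols Y)))"

definition unvectorize :: "nat \<Rightarrow> 'a vec \<Rightarrow> 'a mat" where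
  "unvectorize n = inv_into (carrier_mat n n) vectorize"

definition stack_perm :: "nat \<Rightarrow> 'a :: semiring_1 mat" where
  "stack_perm n = mat_of_rows (n * n)
     (concat (map (\<lambda>i. rows (1\<^sub>m n \<otimes>\<^sub>K mat_of_rows n [unit_vec n i])) [0..<n]))"

text \<open>Only meaningful for invertible arguments; see \<open>mat_inv_invertible\<close>.\<close>

definition mat_inv :: "'a :: field mat \<Rightarrow> 'a mat" where
  "mat_inv A = the (mat_inverse A)"

lemma mat_inv_invertible:
  assumes A: "A \<in> carrier_mat n n" and inv: "invertible_mat A"
  shows "mat_inv A \<in> carrier_mat n n" "A * mat_inv A = 1\<^sub>m n" "mat_inv A * A = 1\<^sub>m n"
proof -
  from inv obtain B where AB: "A * B = 1\<^sub>m n" and BA: "B * A = 1\<^sub>m (dim_row B)"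
    using A unfolding invertible_mat_def inverts_mat_def by auto
  have "dim_row B = n"
    using arg_cong[OF BA, of dim_col] A by simp
  moreover have "dim_col B = n"
    using arg_cong[OF AB, of dim_col] by simp
  ultimately have B: "B \<in> carrier_mat n n" by auto
  have "A \<in> Units (ring_mat TYPE('a) n ())"
    using A B AB BA unfolding Units_def ring_mat_def by auto
  with mat_inverse(1)[OF A, where b = "()"] obtain D where D: "mat_inverse A = Some D"
    by (cases "mat_inverse A") auto
  from mat_inverse(2)[OF A D] D
  show "mat_inv A \<in> carrier_mat n n" "A * mat_inv A = 1\<^sub>m n" "mat_inv A * A = 1\<^sub>m n"
    by (auto simp: mat_inv_def)
qed

lemma length_concat_uniform:
  assumes "\<And>xs. xs \<in> set xss \<Longrightarrow> length xs = n"
  shows "length (concat xss) = length xss * n"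
  using assms by (induction xss) auto

lemma nth_concat_uniform:
  assumes "\<And>xs. xs \<in> set xss \<Longrightarrow> length xs = n" and "k < length xss * n"
  shows "concat xss ! k = xss ! (k div n) ! (k mod n)"
  using assms
proof (induction xss arbitrary: k)
  case (Cons xs xss)
  have n: "n > 0" using Cons.prems(2) by (cases n) auto
  have len: "length xs = n" using Cons.prems(1) by simp
  show ?case
  proof (cases "k < n")
    case True
    then show ?thesis using len by (simp add: nth_append)
  next
    case False
    then have "concat (xs # xss) ! k = xss ! ((k - n) div n) ! ((k - n) mod n)"
      using Cons.IH[of "k - n"] Cons.prems len by (auto simp: nth_append)
    moreover have "k div n = Suc ((k - n) div n)" "k mod n = (k - n) mod n"
      using False n by (simp_all add: le_div_geq le_mod_geq)
    ultimately show ?thesis by simp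
  qed
qed simp

lemma vectorize_carrier:
  assumes Y: "Y \<in> carrier_mat n m"
  shows "vectorize Y \<in> carrier_vec (m * n)"
proof -
  have "length (concat (map list_of_vec (cols Y))) = length (map list_of_vec (cols Y)) * n"
    by (rule length_concat_uniform) (use Y in \<open>auto simp: cols_def\<close>)
  then have "dim_vec (vectorize Y) = m * n"
    using Y by (simp add: vectorize_def del: map_map)
  then show ?thesis by (rule carrier_vecI)
qed

lemma vectorize_index:
  assumes Y: "Y \<in> carrier_mat n m" and k: "k < m * n"
  shows "vectorize Y $ k = Y $$ (k mod n, k div n)"
proof -
  have n: "n > 0" using k by (cases n) auto
  have kd: "k div n < m" using k by (simp add: less_mult_imp_div_less)
  have "vectorize Y $ k = concat (map list_of_vec (cols Y)) ! k"
    by (simp add: vectorize_def vec_of_list_index)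
  also have "\<dots> = map list_of_vec (cols Y) ! (k div n) ! (k mod n)"
    by (rule nth_concat_uniform) (use Y k in \<open>auto simp: cols_def\<close>)
  also have "\<dots> = Y $$ (k mod n, k div n)"
    using Y kd n by (simp add: list_of_vec_index)
  finally show ?thesis .
qed

lemma bij_betw_vectorize:
  "bij_betw vectorize (carrier_mat n n :: 'a mat set) (carrier_vec (n * n))"
proof (rule bij_betw_byWitness[where f' = "\<lambda>v. mat n n (\<lambda>(i, j). v $ (j * n + i))"])
  have idx: "j * n + i < n * n" if "i < n" "j < n" for i j :: nat
  proof -
    have "j * n + i < Suc j * n" using that by simp
    also have "\<dots> \<le> n * n" using that by (intro mult_right_mono) auto
    finally show ?thesis .
  qed
  show "\<forall>Y\<in>carrier_mat n n :: 'a mat set. mat n n (\<lambda>(i, j). vectorize Y $ (j * n + i)) = Y"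
    by (auto intro!: eq_matI simp: vectorize_index[where n = n and m = n] idx)
  show "\<forall>v\<in>carrier_vec (n * n) :: 'a vec set. vectorize (mat n n (\<lambda>(i, j). v $ (j * n + i))) = v"
  proof
    fix v :: "'a vec" assume v: "v \<in> carrier_vec (n * n)"
    let ?Y = "mat n n (\<lambda>(i, j). v $ (j * n + i))"
    have Y: "?Y \<in> carrier_mat n n" by simp
    show "vectorize ?Y = v"
    proof (rule eq_vecI)
      show "dim_vec (vectorize ?Y) = dim_vec v"
        using vectorize_carrier[OF Y] v by (metis carrier_vecD)
      fix k assume "k < dim_vec v"
      then have k: "k < n * n" using v by simp
      then have "n > 0" by (cases n) auto
      with k show "vectorize ?Y $ k = v $ k"
        by (simp add: vectorize_index[OF Y k] less_mult_imp_div_less)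
    qed
  qed
qed (auto simp: vectorize_carrier)

lemma unvectorize_vectorize:
  "Y \<in> carrier_mat n n \<Longrightarrow> unvectorize n (vectorize Y) = Y"
  unfolding unvectorize_def
  by (rule bij_betw_inv_into_left[OF bij_betw_vectorize])

end

theory Submission
  imports Defs "Jordan_Normal_Form.Determinant"
begin

text \<open>The column-stacking map turns \<open>Z W Y\<^sup>T\<close> into \<open>(Y \<otimes> Z) vec W\<close> and the transpose into \<open>P\<^sub>n\<^sub>n\<close>,
  so \<open>c' = vec (C - (M C)\<^sup>T)\<close> and \<open>Q' = C M\<^sup>-\<^sup>T - C\<^sup>T\<close>. Since \<open>M A = B\<^sup>T\<close>, substituting
  \<open>C = A X + X\<^sup>T B\<close> gives \<open>C M\<^sup>-\<^sup>T = A X M\<^sup>-\<^sup>T + X\<^sup>T A\<^sup>T\<close> and \<open>C\<^sup>T = X\<^sup>T A\<^sup>T + M A X\<close>;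
  the term \<open>X\<^sup>T A\<^sup>T\<close> cancels.\<close>

text \<open>Used to split a sum over the stacked index of \<open>vectorize W\<close> into column
  number and offset in the column.\<close>

lemma sum_lessThan_mult:
  fixes f :: "nat \<Rightarrow> 'a :: comm_monoid_add"
  shows "(\<Sum>k<m * n. f k) = (\<Sum>i<m. \<Sum>j<n. f (i * n + j))"
proof -
  have "(\<Sum>k\<in>{i * n..<i * n + n}. f k) = (\<Sum>j<n. f (i * n + j))" for i
    using sum.shift_bounds_nat_ivl[of f 0 "i * n" n]
    by (simp add: atLeast0LessThan add.commute)
  then show ?thesis
    by (simp flip: sum.nat_group)
qed

lemma kron_carrier_mat [simp]:
  assumes "Y \<in> carrier_mat a b" "Z \<in> carrier_mat p q"
  shows "Y \<otimes>\<^sub>K Z \<in> carrier_mat (a * p) (b * q)"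
  using assms by (auto simp: kron_def)

text \<open>Entry \<open>k\<close> of both sides is the double sum of
  \<open>Y $$ (k div p, j) * Z $$ (k mod p, i) * W $$ (i, j)\<close>. Rectangular shapes are allowed
  because \<open>stack_perm_mult_vectorize\<close> takes a single row for \<open>Z\<close>.\<close>

lemma kron_mult_vectorize:
  fixes Y Z W :: "'a :: comm_semiring_0 mat"
  assumes Y: "Y \<in> carrier_mat a b" and Z: "Z \<in> carrier_mat p q" and W: "W \<in> carrier_mat q b"
  shows "(Y \<otimes>\<^sub>K Z) *\<^sub>v vectorize W = vectorize (Z * W * Y\<^sup>T)"
proof (rule eq_vecI)
  have R: "Z * W * Y\<^sup>T \<in> carrier_mat p a" using Y Z W by simp
  note vW = vectorize_carrier[OF W] and K = kron_carrier_mat[OF Y Z]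
  show "dim_vec ((Y \<otimes>\<^sub>K Z) *\<^sub>v vectorize W) = dim_vec (vectorize (Z * W * Y\<^sup>T))"
    using vectorize_carrier[OF R] K by simp
  fix k assume "k < dim_vec (vectorize (Z * W * Y\<^sup>T))"
  then have k: "k < a * p" using vectorize_carrier[OF R] by simp
  have kd: "k div p < a" using k by (simp add: less_mult_imp_div_less)
  have km: "k mod p < p" using k by (cases p) auto
  have idx: "j * q + i < b * q" if "j < b" "i < q" for i j
  proof -
    have "j * q + i < Suc j * q" using that by simp
    also have "\<dots> \<le> b * q" using that by (intro mult_right_mono) auto
    finally show ?thesis .
  qed
  have "((Y \<otimes>\<^sub>K Z) *\<^sub>v vectorize W) $ k = (\<Sum>c<b * q. (Y \<otimes>\<^sub>K Z) $$ (k, c) * vectorize W $ c)"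
    using k K vW by (simp add: scalar_prod_def atLeast0LessThan)
  also have "\<dots> = (\<Sum>j<b. \<Sum>i<q. Y $$ (k div p, j) * Z $$ (k mod p, i) * W $$ (i, j))"
    unfolding sum_lessThan_mult
    using k idx Y Z by (intro sum.cong) (auto simp: kron_def vectorize_index[OF W])
  \<comment> \<open>Commutativity moves the factor from \<open>Y\<close> to the right, where it
    becomes an entry of \<open>Y\<^sup>T\<close>; the inner sum is an entry of
    \<open>Z * W\<close>.\<close>
  also have "\<dots> = (\<Sum>j<b. (\<Sum>i<q. Z $$ (k mod p, i) * W $$ (i, j)) * Y $$ (k div p, j))"
    by (simp add: sum_distrib_left sum_distrib_right mult_ac)
  also have "\<dots> = (Z * W * Y\<^sup>T) $$ (k mod p, k div p)"
    using Y Z W kd km by (simp add: scalar_prod_def atLeast0LessThan del: assoc_mult_mat)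
  also have "\<dots> = vectorize (Z * W * Y\<^sup>T) $ k"
    by (simp add: vectorize_index[OF R k])
  finally show "((Y \<otimes>\<^sub>K Z) *\<^sub>v vectorize W) $ k = vectorize (Z * W * Y\<^sup>T) $ k" .
qed

lemma stack_perm_carrier: "(stack_perm n :: 'a :: semiring_1 mat) \<in> carrier_mat (n * n) (n * n)"
proof -
  let ?b = "\<lambda>i. 1\<^sub>m n \<otimes>\<^sub>K mat_of_rows n [unit_vec n i] :: 'a mat"
  have "length (concat (map (\<lambda>i. rows (?b i)) [0..<n])) = length (map (\<lambda>i. rows (?b i)) [0..<n]) * n"
    by (rule length_concat_uniform) (auto simp: kron_def)
  then show ?thesis
    by (auto simp: stack_perm_def simp del: length_concat)
qed

text \<open>Each block has exactly \<open>n\<close> rows, so quotient and remainder of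
  \<open>k\<close> by \<open>n\<close> locate the block and the row in it.\<close>

lemma row_stack_perm:
  assumes k: "k < n * n"
  shows "row (stack_perm n :: 'a :: semiring_1 mat) k = row (1\<^sub>m n \<otimes>\<^sub>K mat_of_rows n [unit_vec n (k div n)]) (k mod n)"
proof -
  let ?b = "\<lambda>i. 1\<^sub>m n \<otimes>\<^sub>K mat_of_rows n [unit_vec n i] :: 'a mat"
  let ?rs = "concat (map (\<lambda>i. rows (?b i)) [0..<n])"
  have kd: "k div n < n" using k by (simp add: less_mult_imp_div_less)
  have km: "k mod n < n" using k by (cases n) auto
  have b: "?b i \<in> carrier_mat n (n * n)" for i
    using kron_carrier_mat[OF one_carrier_mat mat_of_rows_carrier(1)[of n "[unit_vec n i]"], of n]
    by simp
  have "?rs ! k = map (\<lambda>i. rows (?b i)) [0..<n] ! (k div n) ! (k mod n)"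
    by (rule nth_concat_uniform) (use k carrier_matD[OF b] in auto)
  also have "\<dots> = row (?b (k div n)) (k mod n)"
    using b[of "k div n"] kd km by simp
  finally have nth: "?rs ! k = row (?b (k div n)) (k mod n)" .
  have "k < length ?rs"
    using stack_perm_carrier[of n, where 'a = 'a] k by (metis carrier_matD(1) mat_of_rows_carrier(2) stack_perm_def)
  then have "row (stack_perm n) k = ?rs ! k"
    unfolding stack_perm_def by (rule mat_of_rows_row) (use nth carrier_matD[OF b[of "k div n"]] in \<open>auto intro!: carrier_vecI\<close>)
  with nth show ?thesis by simp
qed

text \<open>Block \<open>i\<close> sends \<open>vectorize Y\<close> to row \<open>i\<close> of
  \<open>Y\<close>, and stacking the rows of \<open>Y\<close> is stacking the columns of
  \<open>Y\<^sup>T\<close>.\<close>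

lemma stack_perm_mult_vectorize:
  fixes Y :: "'a :: comm_semiring_1 mat"
  assumes Y: "Y \<in> carrier_mat n n"
  shows "stack_perm n *\<^sub>v vectorize Y = vectorize Y\<^sup>T"
proof (rule eq_vecI)
  have YT: "Y\<^sup>T \<in> carrier_mat n n" using Y by simp
  show "dim_vec (stack_perm n *\<^sub>v vectorize Y) = dim_vec (vectorize Y\<^sup>T)"
    using vectorize_carrier[OF YT] stack_perm_carrier[of n, where 'a = 'a] by simp
  fix k assume "k < dim_vec (vectorize Y\<^sup>T)"
  then have k: "k < n * n" using vectorize_carrier[OF YT] by simp
  have kd: "k div n < n" using k by (simp add: less_mult_imp_div_less)
  have km: "k mod n < n" using k by (cases n) auto
  let ?e = "mat_of_rows n [unit_vec n (k div n)] :: 'a mat"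
  have e: "?e \<in> carrier_mat 1 n" using mat_of_rows_carrier(1)[of n "[unit_vec n (k div n)]"] by simp
  have eY: "?e * Y \<in> carrier_mat 1 n" using e Y by simp
  have "(stack_perm n *\<^sub>v vectorize Y) $ k = row (stack_perm n) k \<bullet> vectorize Y"
    using k stack_perm_carrier[of n, where 'a = 'a] by simp
  also have "\<dots> = ((1\<^sub>m n \<otimes>\<^sub>K ?e) *\<^sub>v vectorize Y) $ (k mod n)"
    using kron_carrier_mat[OF one_carrier_mat e, of n] km by (simp add: row_stack_perm[OF k])
  \<comment> \<open>The Kronecker identity with a unit row vector as second factor:
    \<open>?e * Y\<close> is row \<open>k div n\<close> of \<open>Y\<close>.\<close>
  also have "\<dots> = vectorize (?e * Y) $ (k mod n)"
    using kron_mult_vectorize[OF one_carrier_mat e Y] right_mult_one_mat[OF eY] by simp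
  also have "\<dots> = (?e * Y) $$ (0, k mod n)"
    using km by (simp add: vectorize_index[OF eY])
  also have "\<dots> = Y $$ (k div n, k mod n)"
    using e Y km kd scalar_prod_left_unit[OF col_carrier_vec[OF km Y] kd]
    by (simp add: mat_of_rows_row)
  also have "\<dots> = vectorize Y\<^sup>T $ k"
    using Y kd km by (simp add: vectorize_index[OF YT k])
  finally show "(stack_perm n *\<^sub>v vectorize Y) $ k = vectorize Y\<^sup>T $ k" .
qed

lemma vectorize_minus:
  fixes Y Z :: "'a :: minus mat"
  assumes Y: "Y \<in> carrier_mat n m" and Z: "Z \<in> carrier_mat n m"
  shows "vectorize (Y - Z) = vectorize Y - vectorize Z"
proof -
  have YZ: "Y - Z \<in> carrier_mat n m" using Z by (simp add: minus_mat_def)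
  show ?thesis
  proof (rule eq_vecI)
    show "dim_vec (vectorize (Y - Z)) = dim_vec (vectorize Y - vectorize Z)"
      using vectorize_carrier[OF YZ] vectorize_carrier[OF Z] by simp
    fix k assume "k < dim_vec (vectorize Y - vectorize Z)"
    then have k: "k < m * n" using vectorize_carrier[OF Z] by simp
    moreover have "k div n < m" using k by (simp add: less_mult_imp_div_less)
    moreover have "k mod n < n" using k by (cases n) auto
    ultimately show "vectorize (Y - Z) $ k = (vectorize Y - vectorize Z) $ k"
      using Y Z vectorize_carrier[OF Z]
      by (simp add: vectorize_index[OF YZ] vectorize_index[OF Y] vectorize_index[OF Z])
  qed
qed

text \<open>The closing cancellation of the theorem, with \<open>X\<^sup>T * A\<^sup>T\<close> as
  \<open>V\<close>.\<close>

lemma minus_add_cancel_right_mat: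
  fixes U V W :: "'a :: ab_group_add mat"
  assumes "U \<in> carrier_mat n m" "V \<in> carrier_mat n m" "W \<in> carrier_mat n m"
  shows "(U + V) - (V + W) = - W + U"
  using assms by (auto intro!: eq_matI)

theorem corollary3p3:
  fixes A B C X :: "real mat" and n :: nat
  assumes "A \<in> carrier_mat n n" and "B \<in> carrier_mat n n"
    and "C \<in> carrier_mat n n" and "X \<in> carrier_mat n n"
    and "invertible_mat A" and "invertible_mat B"
  shows "let M = B\<^sup>T * mat_inv A;
             X' = A * X;
             c' = (1\<^sub>m n \<otimes>\<^sub>K 1\<^sub>m n - stack_perm n * (1\<^sub>m n \<otimes>\<^sub>K M)) *\<^sub>v vectorize C;
             Q' = unvectorize n ((mat_inv M \<otimes>\<^sub>K 1\<^sub>m n) *\<^sub>v c')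
         in invertible_mat M \<and>
            (A * X + X\<^sup>T * B = C \<longrightarrow> - M * X' + X' * (mat_inv M)\<^sup>T = Q')"
proof -
  note A = assms(1) and B = assms(2) and C = assms(3) and X = assms(4)
  note A' = mat_inv_invertible[OF A assms(5)] and B' = mat_inv_invertible[OF B assms(6)]
  define M where "M = B\<^sup>T * mat_inv A"
  have M: "M \<in> carrier_mat n n" using A' B by (simp add: M_def)
  have MA: "M * A = B\<^sup>T"
    using A A' B unfolding M_def by (simp add: assoc_mult_mat[of _ n n _ n _ n])
  \<comment> \<open>The inverse of \<open>B\<^sup>T * mat_inv A\<close> should be \<open>A\<close>
    times the inverse of \<open>B\<^sup>T\<close>, and the latter is
    \<open>(mat_inv B)\<^sup>T\<close>.\<close>
  have "M * (A * (mat_inv B)\<^sup>T) = M * A * (mat_inv B)\<^sup>T"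
    using M A B' by (simp add: assoc_mult_mat[of _ n n _ n _ n])
  also have "\<dots> = (mat_inv B * B)\<^sup>T"
    using transpose_mult[OF B'(1) B] by (simp add: MA)
  finally have right: "M * (A * (mat_inv B)\<^sup>T) = 1\<^sub>m n" using B' by simp
  have R: "A * (mat_inv B)\<^sup>T \<in> carrier_mat n n" using A B' by simp
  \<comment> \<open>For square matrices over a field, a right inverse is also a left
    inverse.\<close>
  have "invertible_mat M"
    using M R right mat_mult_left_right_inverse[OF M R right]
    by (auto simp: invertible_mat_def inverts_mat_def intro!: exI[of _ "A * (mat_inv B)\<^sup>T"])
  note M' = mat_inv_invertible[OF M this]
  let ?N = "(mat_inv M)\<^sup>T"
  have N: "?N \<in> carrier_mat n n" using M' by simp
  \<comment> \<open>Aims at \<open>B * ?N = A\<^sup>T\<close>, which will turn the term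
    \<open>X\<^sup>T * B\<close> of the equation into \<open>X\<^sup>T * A\<^sup>T\<close>.\<close>
  have "B = A\<^sup>T * M\<^sup>T"
    using arg_cong[OF MA, of transpose_mat] M A by (simp add: transpose_mult)
  then have "B * ?N = A\<^sup>T * (mat_inv M * M)\<^sup>T"
    using M A M'(1) by (simp add: transpose_mult assoc_mult_mat[of _ n n _ n _ n])
  then have BN: "B * ?N = A\<^sup>T" using M' A by simp

  let ?I = "1\<^sub>m n :: real mat" and ?P = "stack_perm n :: real mat"
  have P: "?P \<in> carrier_mat (n * n) (n * n)" by (rule stack_perm_carrier)
  have D: "C - (M * C)\<^sup>T \<in> carrier_mat n n" using C M by auto
  define c where "c = (?I \<otimes>\<^sub>K ?I - ?P * (?I \<otimes>\<^sub>K M)) *\<^sub>v vectorize C"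
  \<comment> \<open>The large matrices are applied to the vector one at a time, so that the
    identities for \<open>vectorize\<close> replace any computation of their product.\<close>
  have "c = (?I \<otimes>\<^sub>K ?I) *\<^sub>v vectorize C - ?P *\<^sub>v ((?I \<otimes>\<^sub>K M) *\<^sub>v vectorize C)"
    unfolding c_def
    using P kron_carrier_mat[OF one_carrier_mat one_carrier_mat, of n n]
      kron_carrier_mat[OF one_carrier_mat M, of n] vectorize_carrier[OF C]
    by (simp add: minus_mult_distrib_mat_vec[of _ "n * n" "n * n"]
        assoc_mult_mat_vec[of _ "n * n" "n * n" _ "n * n"])
  also have "\<dots> = vectorize (C - (M * C)\<^sup>T)"
    using C M
    by (simp add: kron_mult_vectorize[of _ n n _ n n] stack_perm_mult_vectorize
        vectorize_minus[of _ n n])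
  finally have c: "c = vectorize (C - (M * C)\<^sup>T)" .
  have "unvectorize n ((mat_inv M \<otimes>\<^sub>K ?I) *\<^sub>v c) = (C - (M * C)\<^sup>T) * ?N"
    using D M' N left_mult_one_mat[OF D] by (simp add: c kron_mult_vectorize[of _ n n _ n n] unvectorize_vectorize)
  \<comment> \<open>Here \<open>(M * C)\<^sup>T * ?N = C\<^sup>T * (M\<^sup>T * ?N)\<close>, and the
    bracket is the transpose of \<open>mat_inv M * M\<close>. The formula for Q' thus holds for
    every \<open>C\<close>, before the equation is used.\<close>
  also have "\<dots> = C * ?N - C\<^sup>T * (mat_inv M * M)\<^sup>T"
    using C M M'(1)
    by (simp add: minus_mult_distrib_mat[of _ n n _ _ n] transpose_mult[of _ n n _ n]
        assoc_mult_mat[of _ n n _ n _ n])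
  finally have Q: "unvectorize n ((mat_inv M \<otimes>\<^sub>K ?I) *\<^sub>v c) = C * ?N - C\<^sup>T"
    using C M' by simp

  have "- M * (A * X) + A * X * ?N = C * ?N - C\<^sup>T" if eq: "A * X + X\<^sup>T * B = C"
  proof -
    have "C * ?N = A * X * ?N + X\<^sup>T * (B * ?N)"
      unfolding eq[symmetric] using A X B N
      by (simp add: add_mult_distrib_mat[of _ n n _ _ n] assoc_mult_mat[of _ n n _ n _ n])
    \<comment> \<open>Transposing \<open>X\<^sup>T * B\<close> gives \<open>B\<^sup>T * X\<close>,
      which is \<open>M * (A * X)\<close> by \<open>MA\<close>.\<close>
    moreover have "C\<^sup>T = X\<^sup>T * A\<^sup>T + M * (A * X)"
      unfolding eq[symmetric] using A X B M
      by (simp add: transpose_add[of _ n n] transpose_mult[of _ n n _ n] MA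
          flip: assoc_mult_mat[of _ n n _ n _ n])
    moreover have "A * X * ?N \<in> carrier_mat n n" "X\<^sup>T * A\<^sup>T \<in> carrier_mat n n"
      "M * (A * X) \<in> carrier_mat n n"
      using A X M N by auto
    \<comment> \<open>The sign binds to \<open>M\<close> alone and is pulled out of the product to
      fit the cancellation lemma.\<close>
    moreover have "- M * (A * X) = - (M * (A * X))"
      using A X M by simp
    ultimately show ?thesis
      unfolding BN by (metis minus_add_cancel_right_mat)
  qed
  with \<open>invertible_mat M\<close> Q show ?thesis
    unfolding Let_def M_def[symmetric] c_def by metis
qed

end
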